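(* Let $D$ be a (possibly unbounded) self-adjoint operator on a Hilbert space $H$ such that the spectrum of $D$ is contained in $\mathbb{Z}$, and let $K=\{a\in B(H) : \|[D,a]\|\le 1 \text{ and } \rho_0(a)=0\}$. Then every element of $K$ has norm at most $\frac{\pi}{\sqrt{3}}$. Moreover, for every $a\in B(H)$ such that $\|[D,a]\|\le 1$, the sum $\sum_{m\in\mathbb{Z}}\rho_m(a)$ is norm convergent and $$\forall k\in\mathbb{N},\ k\geq 1:\quad \Big\|\sum_{|m|>k}\rho_m(a)\Big\|\le\sqrt{\frac{2}{k}}.$$
   Context: For $m\in\mathbb{Z}$ let $H_m$ be the eigenspace of $D$ for the eigenvalue $m$ (possibly $\{0\}$), so that $H=\bigoplus_{m\in\mathbb{Z}}H_m$, and every $x\in B(H)$ has a matrix $x=(x_{i,j})_{i,j\in\mathbb{Z}}$ with $x_{i,j}\in B(H_j,H_i)$. For $k\in\mathbb{Z}$, $\rho_k:B(H)\to B(H)$ is the projection onto the $k$'th diagonal: $\rho_k(x)$ is the bounded operator with matrix entries $\rho_k(x)_{m,n}=x_{m,n}$ if $m-n=k$ and $\rho_k(x)_{m,n}=0$ if $m-n\ne k$. The condition $\|[D,a]\|\le 1$ means that $a(\mathrm{dom}(D))\subseteq\mathrm{dom}(D)$ and that $Da-aD$, defined on $\mathrm{dom}(D)$, is bounded with norm at most $1$. Norm convergence of $\sum_{m\in\mathbb{Z}}\rho_m(a)$ refers to the partial sums $\sum_{|m|\le n}\rho_m(a)$ as $n\to\infty$, and $\sum_{|m|>k}\rho_m(a)$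 is the norm limit of $\sum_{k<|m|\le n}\rho_m(a)$ as $n\to\infty$. *)

theory Defs
  imports "HOL-Analysis.Analysis"
begin

text \<open>Complex Hilbert spaces. The real inner product and the norm are those of the class
  \<^class>\<open>real_inner\<close>; the axiom \<open>inner_eq_Re_cinner\<close> ties them to the complex inner product, so that
  positive definiteness and \<open>norm x = sqrt (Re (cinner x x))\<close> are inherited. The complex inner
  product is conjugate linear in its first argument.\<close>

class complex_hilbert_space = real_inner + banach +
  fixes scaleC :: "complex \<Rightarrow> 'a \<Rightarrow> 'a" (infixr "*\<^sub>C" 75)
    and cinner :: "'a \<Rightarrow> 'a \<Rightarrow> complex"
  assumes scaleC_add_right: "c *\<^sub>C (x + y) = c *\<^sub>C x + c *\<^sub>C y"
    and scaleC_add_left: "(c + d) *\<^sub>C x = c *\<^sub>C x + d *\<^sub>C x"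
    and scaleC_scaleC: "c *\<^sub>C (d *\<^sub>C x) = (c * d) *\<^sub>C x"
    and scaleC_of_real: "complex_of_real r *\<^sub>C x = r *\<^sub>R x"
    and cinner_commute: "cinner x y = cnj (cinner y x)"
    and cinner_add_right: "cinner x (y + z) = cinner x y + cinner x z"
    and cinner_scaleC_right: "cinner x (c *\<^sub>C y) = c * cinner x y"
    and inner_eq_Re_cinner: "inner x y = Re (cinner x y)"

text \<open>The algebra \<open>B(H)\<close>. A \<^typ>\<open>'a \<Rightarrow>\<^sub>L 'a\<close> is only real-linear, hence the explicit condition; its
  norm is the operator norm.\<close>

definition bounded_ops :: "('a::complex_hilbert_space \<Rightarrow>\<^sub>L 'a) set" where
  "bounded_ops = {a. \<forall>c x. blinfun_apply a (c *\<^sub>C x) = c *\<^sub>C blinfun_apply a x}"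

text \<open>A possibly unbounded operator is a partial function \<open>D\<close>, with domain \<open>dom D\<close> and
  value \<open>the (D x)\<close> at \<open>x \<in> dom D\<close>.\<close>

definition complex_subspace :: "'a::complex_hilbert_space set \<Rightarrow> bool" where
  "complex_subspace S \<longleftrightarrow>
     0 \<in> S \<and> (\<forall>x\<in>S. \<forall>y\<in>S. x + y \<in> S) \<and> (\<forall>c. \<forall>x\<in>S. c *\<^sub>C x \<in> S)"

definition linear_operator :: "('a::complex_hilbert_space \<rightharpoonup> 'a) \<Rightarrow> bool" where
  "linear_operator D \<longleftrightarrow> complex_subspace (dom D) \<and>
     (\<forall>x\<in>dom D. \<forall>y\<in>dom D. the (D (x + y)) = the (D x) + the (D y)) \<and>
     (\<forall>c. \<forall>x\<in>dom D. the (D (c *\<^sub>C x)) = c *\<^sub>C the (D x))"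

text \<open>Meaningful for densely defined \<open>D\<close>, where the vector \<open>z\<close> is unique.\<close>

definition adjoint_operator ::
    "('a::complex_hilbert_space \<rightharpoonup> 'a) \<Rightarrow> ('a \<rightharpoonup> 'a)" where
  "adjoint_operator D y =
     (if \<exists>z. \<forall>x\<in>dom D. cinner y (the (D x)) = cinner z x
      then Some (THE z. \<forall>x\<in>dom D. cinner y (the (D x)) = cinner z x)
      else None)"

definition self_adjoint :: "('a::complex_hilbert_space \<rightharpoonup> 'a) \<Rightarrow> bool" where
  "self_adjoint D \<longleftrightarrow>
     linear_operator D \<and> closure (dom D) = UNIV \<and> adjoint_operator D = D"

definition resolvent_set :: "('a::complex_hilbert_space \<rightharpoonup> 'a) \<Rightarrow> complex set" where
  "resolvent_set D =
     {c. bij_betw (\<lambda>x. the (D x) - c *\<^sub>C x) (dom D) UNIV \<and>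
         bounded_linear (inv_into (dom D) (\<lambda>x. the (D x) - c *\<^sub>C x))}"

definition operator_spectrum :: "('a::complex_hilbert_space \<rightharpoonup> 'a) \<Rightarrow> complex set" where
  "operator_spectrum D = - resolvent_set D"

definition eigenspace :: "('a::complex_hilbert_space \<rightharpoonup> 'a) \<Rightarrow> int \<Rightarrow> 'a set" where
  "eigenspace D m = {x \<in> dom D. the (D x) = of_int m *\<^sub>C x}"

definition orth_proj :: "'a::complex_hilbert_space set \<Rightarrow> 'a \<Rightarrow> 'a" where
  "orth_proj S x = (THE p. p \<in> S \<and> (\<forall>h\<in>S. cinner h (x - p) = 0))"

text \<open>The matrix entry \<open>x\<^sub>i\<^sub>j \<in> B(H\<^sub>j, H\<^sub>i)\<close> is the restriction of \<open>matrix_entry D x i\<close>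
  to the eigenspace \<open>H\<^sub>j\<close>.\<close>

definition matrix_entry ::
    "('a::complex_hilbert_space \<rightharpoonup> 'a) \<Rightarrow> ('a \<Rightarrow>\<^sub>L 'a) \<Rightarrow> int \<Rightarrow> 'a \<Rightarrow> 'a" where
  "matrix_entry D x i h = orth_proj (eigenspace D i) (blinfun_apply x h)"

text \<open>The map \<open>\<rho>\<^sub>k\<close>. The description determines \<open>y\<close> only when \<open>H\<close> is the Hilbert sum of the
  eigenspaces \<open>H\<^sub>m\<close>, \<open>m \<in> \<int>\<close>, as for a self-adjoint \<open>D\<close> with spectrum in \<open>\<int>\<close>.\<close>

definition diag_proj ::
    "('a::complex_hilbert_space \<rightharpoonup> 'a) \<Rightarrow> int \<Rightarrow> ('a \<Rightarrow>\<^sub>L 'a) \<Rightarrow> ('a \<Rightarrow>\<^sub>L 'a)" where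
  "diag_proj D k x = (THE y. y \<in> bounded_ops \<and>
     (\<forall>m n. \<forall>h\<in>eigenspace D n.
        matrix_entry D y m h = (if m - n = k then matrix_entry D x m h else 0)))"

definition commutator_le_one ::
    "('a::complex_hilbert_space \<rightharpoonup> 'a) \<Rightarrow> ('a \<Rightarrow>\<^sub>L 'a) \<Rightarrow> bool" where
  "commutator_le_one D a \<longleftrightarrow>
     blinfun_apply a ` dom D \<subseteq> dom D \<and>
     (\<forall>x\<in>dom D. norm (the (D (blinfun_apply a x)) - blinfun_apply a (the (D x))) \<le> norm x)"

definition K_set :: "('a::complex_hilbert_space \<rightharpoonup> 'a) \<Rightarrow> ('a \<Rightarrow>\<^sub>L 'a) set" where
  "K_set D = {a \<in> bounded_ops. commutator_le_one D a \<and> diag_proj D 0 a = 0}"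

end

theory Submission
  imports Defs
begin

text \<open>Diagonal estimate: let \<open>P\<^sub>j\<close> be the projection onto \<open>H\<^sub>j\<close> and \<open>x\<^sub>j = P\<^sub>j x\<close>. The vectors
  \<open>P\<^bsub>j+m\<^esub> a x\<^sub>j\<close>, \<open>j \<in> \<int>\<close>, are pairwise orthogonal with sum \<open>\<rho>\<^sub>m(a) x\<close>, and
  \<open>m P\<^bsub>j+m\<^esub> a x\<^sub>j = P\<^bsub>j+m\<^esub> [D,a] x\<^sub>j\<close>. Summing squared norms over \<open>m\<close> and \<open>j\<close>,
  Bessel's inequality and \<open>\<parallel>[D,a]\<parallel> \<le> 1\<close> give \<open>\<Sum>\<^sub>m m\<^sup>2 \<parallel>\<rho>\<^sub>m(a) x\<parallel>\<^sup>2 \<le> \<parallel>x\<parallel>\<^sup>2\<close>, so by Cauchy--Schwarz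
  a sum of \<open>\<rho>\<^sub>m(a)\<close> over a finite set \<open>F\<close> of nonzero \<open>m\<close> has norm at most the square root of
  \<open>\<Sum>\<^bsub>m\<in>F\<^esub> 1/m\<^sup>2\<close>.

  Completeness of the eigenspaces: symmetric operators are bounded by their spectral radius.
  Applied to the inverse of \<open>(D - m)\<^sup>2 - 1/2\<close>, this bounds \<open>D - m\<close> below by \<open>1\<close> on its range, which
  yields the projection onto \<open>H\<^sub>m\<close> and bounds \<open>D - m\<close> below by \<open>1\<close> on the orthogonal complement of \<open>H\<^sub>m\<close>.
  So \<open>(D - 1/2)\<^sup>-\<^sup>1\<close> has spectral radius \<open>0\<close> on the intersection of these complements, which
  is therefore \<open>{0}\<close>.\<close>

subsection \<open>Symmetric operators and orthogonal series\<close>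

text \<open>The norm of a symmetric operator is its spectral radius: with \<open>t\<close> the norm of \<open>T\<close> on \<open>M\<close>,
  \<open>1 - T\<^sup>2 / t\<^sup>2\<close> cannot be bounded below. Hypothesis \<open>res\<close> says that \<open>1 - r T\<close> is bounded below,
  in a form suited to resolvents \<open>T\<close> of an unbounded operator.\<close>

lemma symmetric_norm_le:
  fixes T :: "'a::real_inner \<Rightarrow> 'a"
  assumes T: "bounded_linear T" and M: "subspace M" and inv: "\<And>x. x \<in> M \<Longrightarrow> T x \<in> M"
    and sym: "\<And>x y. x \<in> M \<Longrightarrow> y \<in> M \<Longrightarrow> inner (T x) y = inner x (T y)"
    and d: "d > 0"
    and res: "\<And>r. \<bar>r\<bar> < d \<Longrightarrow> \<exists>K. \<forall>x\<in>M. norm (T x) \<le> K * norm (x - r *\<^sub>R T x)"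
    and x: "x \<in> M"
  shows "d * norm (T x) \<le> norm x"
proof -
  interpret T: bounded_linear T by (rule T)
  define Q where "Q = {c. 0 \<le> c \<and> (\<forall>x\<in>M. norm (T x) \<le> c * norm x)}"
  define t where "t = Inf Q"
  obtain K where K: "K \<ge> 0" "\<And>x. norm (T x) \<le> norm x * K"
    using T.nonneg_bounded by blast
  have Qne: "Q \<noteq> {}" using K by (auto simp: Q_def mult.commute)
  have bdd: "bdd_below Q" by (rule bdd_belowI[of _ 0]) (auto simp: Q_def)
  have t0: "t \<ge> 0" unfolding t_def by (rule cInf_greatest[OF Qne]) (auto simp: Q_def)
  have tb: "norm (T x) \<le> t * norm x" if "x \<in> M" for x
  proof (cases "x = 0")
    case False
    have "norm (T x) / norm x \<le> t" unfolding t_def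
      by (rule cInf_greatest[OF Qne]) (use False that in \<open>auto simp: Q_def field_simps\<close>)
    then show ?thesis using False by (simp add: field_simps)
  qed (simp add: T.zero)
  have td: "t * d \<le> 1"
  proof (rule ccontr)
    assume "\<not> t * d \<le> 1"
    then have td: "1 < t * d" by simp
    then have tp: "t > 0" using d t0 by (metis less_eq_real_def mult_zero_left not_one_less_zero)
    have r: "1 / t < d" using td tp by (simp add: field_simps)
    \<comment> \<open>The bound on \<open>T x\<close> from \<open>res\<close> becomes one on
      \<open>x\<close>, since \<open>x = (x - r T x) + r T x\<close>.\<close>
    have bb: "\<exists>L>0. \<forall>x\<in>M. norm x \<le> L * norm (x - r *\<^sub>R T x)" if r: "\<bar>r\<bar> < d" for r
    proof -
      obtain K where K: "\<And>x. x \<in> M \<Longrightarrow> norm (T x) \<le> K * norm (x - r *\<^sub>R T x)"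
        using res[OF r] by blast
      have "norm x \<le> (1 + \<bar>r\<bar> * \<bar>K\<bar>) * norm (x - r *\<^sub>R T x)" if "x \<in> M" for x
      proof -
        have "norm x \<le> norm (x - r *\<^sub>R T x) + norm (r *\<^sub>R T x)"
          by (metis diff_add_cancel norm_triangle_ineq)
        also have "norm (r *\<^sub>R T x) \<le> \<bar>r\<bar> * (\<bar>K\<bar> * norm (x - r *\<^sub>R T x))"
          using K[OF that] by (auto intro!: mult_left_mono order.trans[OF K[OF that]] mult_right_mono)
        finally show ?thesis by (simp add: algebra_simps)
      qed
      moreover have "1 + \<bar>r\<bar> * \<bar>K\<bar> > 0" by (simp add: add_pos_nonneg)
      ultimately show ?thesis by blast
    qed
    obtain L1 where L1: "L1 > 0" "\<And>x. x \<in> M \<Longrightarrow> norm x \<le> L1 * norm (x - (1/t) *\<^sub>R T x)"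
      using bb[of "1/t"] r tp by auto
    obtain L2 where L2: "L2 > 0" "\<And>x. x \<in> M \<Longrightarrow> norm x \<le> L2 * norm (x - (-1/t) *\<^sub>R T x)"
      using bb[of "-1/t"] r tp by auto
    define L where "L = L1 * L2"
    have L: "L > 0" using L1 L2 by (simp add: L_def)
    \<comment> \<open>Factor \<open>1 - T^2/t^2 = (1 + T/t) (1 - T/t)\<close>; both factors are
      bounded below because \<open>1/t < d\<close>.\<close>
    have xb: "norm x \<le> L * norm (x - (1/t^2) *\<^sub>R T (T x))" if x: "x \<in> M" for x
    proof -
      define y where "y = x - (1/t) *\<^sub>R T x"
      have y: "y \<in> M" unfolding y_def using x inv M by (simp add: subspace_diff subspace_scale)
      have e: "y - (-1/t) *\<^sub>R T y = x - (1/t^2) *\<^sub>R T (T x)"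
        unfolding y_def by (simp add: T.diff T.scaleR algebra_simps power2_eq_square)
      have "norm x \<le> L1 * norm y" using L1(2)[OF x] by (simp add: y_def)
      also have "\<dots> \<le> L1 * (L2 * norm (y - (-1/t) *\<^sub>R T y))"
        using L1(1) L2(2)[OF y] by (simp add: mult_left_mono)
      finally show ?thesis unfolding e by (simp add: L_def mult.assoc)
    qed
    \<comment> \<open>Solving \<open>norm x^2 \<le> L^2 (norm x^2 - norm (T x)^2 / t^2)\<close> for
      \<open>norm (T x)\<close> gives the factor \<open>c < t\<close>, against the minimality of
      \<open>t\<close>. The \<open>max\<close> keeps the root real when
      \<open>L < 1\<close>.\<close>
    define c where "c = t * sqrt (max 0 (1 - 1 / L^2))"
    have "norm (T x) \<le> c * norm x" if x: "x \<in> M" for x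
    proof -
      have "norm (x - (1/t^2) *\<^sub>R T (T x))^2
          = norm x^2 - 2 * (1/t^2) * inner x (T (T x)) + (1/t^2)^2 * norm (T (T x))^2"
        by (simp add: power2_norm_eq_inner inner_diff inner_commute power_divide algebra_simps)
      also have "inner x (T (T x)) = norm (T x)^2"
        using sym[of x "T x"] x inv by (simp add: power2_norm_eq_inner)
      also have "norm (T (T x))^2 \<le> (t * norm (T x))^2"
        using tb[OF inv[OF x]] by (rule power_mono) simp
      also have "(1/t^2)^2 * (t * norm (T x))^2 = (1/t^2) * norm (T x)^2"
        using tp by (simp add: power2_eq_square field_simps)
      finally have n: "norm (x - (1/t^2) *\<^sub>R T (T x))^2 \<le> norm x^2 - (1/t^2) * norm (T x)^2"
        by (simp add: mult_left_mono)
      have "norm x^2 \<le> (L * norm (x - (1/t^2) *\<^sub>R T (T x)))^2"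
        using xb[OF x] by (rule power_mono) simp
      then have "norm x^2 \<le> L^2 * (norm x^2 - (1/t^2) * norm (T x)^2)"
        using n L by (smt (verit) mult_left_mono power_mult_distrib zero_le_power2)
      then have "norm (T x)^2 \<le> t^2 * ((1 - 1/L^2) * norm x^2)"
        using L tp by (simp add: field_simps)
      also have "\<dots> \<le> t^2 * (max 0 (1 - 1/L^2) * norm x^2)"
        by (intro mult_left_mono mult_right_mono) auto
      also have "\<dots> = (c * norm x)^2" by (simp add: c_def power_mult_distrib)
      finally show ?thesis
        by (rule power2_le_imp_le) (use tp in \<open>auto simp: c_def\<close>)
    qed
    then have "c \<in> Q" using tp by (auto simp: Q_def c_def)
    then have "t \<le> c" unfolding t_def by (rule cInf_lower[OF _ bdd])
    moreover have "c < t" unfolding c_def using tp L by (simp add: real_sqrt_lt_1_iff)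
    ultimately show False by simp
  qed
  have "d * norm (T x) \<le> d * (t * norm x)" using tb[OF x] d by simp
  also have "\<dots> = (t * d) * norm x" by simp
  also have "\<dots> \<le> 1 * norm x" using td by (rule mult_right_mono) simp
  finally show ?thesis by simp
qed

text \<open>By Pythagoras, partial sums over nested finite sets differ in squared norm by a partial
  sum of the bounded series of squares, so the net of partial sums is Cauchy. Continuity of the norm
  then gives the second claim.\<close>

lemma
  fixes u :: "'i \<Rightarrow> 'a::{real_inner, banach}"
  assumes orth: "\<And>i j. i \<noteq> j \<Longrightarrow> inner (u i) (u j) = 0"
    and bound: "\<And>F. finite F \<Longrightarrow> (\<Sum>i\<in>F. (norm (u i))\<^sup>2) \<le> C"
  shows orthogonal_summable: "u summable_on UNIV"
    and orthogonal_has_sum_norm2: "((\<lambda>i. (norm (u i))\<^sup>2) has_sum (norm (infsum u UNIV))\<^sup>2) UNIV"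
proof -
  have pyth: "(norm (sum u F))\<^sup>2 = (\<Sum>i\<in>F. (norm (u i))\<^sup>2)" if "finite F" for F
    using that by (rule norm_sum_Pythagorean) (auto simp: pairwise_def orthogonal_def orth)
  have sq: "(\<lambda>i. (norm (u i))\<^sup>2) summable_on UNIV"
    by (rule nonneg_bdd_above_summable_on) (auto intro!: bdd_aboveI2 bound)
  then obtain s where s: "((\<lambda>i. (norm (u i))\<^sup>2) has_sum s) UNIV"
    by (auto simp: summable_on_def)
  have "\<exists>P. eventually P (finite_subsets_at_top UNIV) \<and>
      (\<forall>F F'. P F \<and> P F' \<longrightarrow> dist (sum u F) (sum u F') < e)" if e: "e > 0" for e
  proof -
    obtain F0 where F0: "finite F0" "dist (\<Sum>i\<in>F0. (norm (u i))\<^sup>2) s \<le> (e/3)\<^sup>2"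
      using has_sum_finite_approximation[OF s, of "(e/3)\<^sup>2"] e by auto
    define P where "P F \<longleftrightarrow> finite F \<and> F0 \<subseteq> F" for F
    have near: "dist (sum u F) (sum u F0) \<le> e/3" if "P F" for F
    proof -
      have F: "finite F" "F0 \<subseteq> F" using that by (auto simp: P_def)
      have "(dist (sum u F) (sum u F0))\<^sup>2 = (norm (sum u (F - F0)))\<^sup>2"
        using F by (simp add: dist_norm sum_diff)
      also have "\<dots> = (\<Sum>i\<in>F. (norm (u i))\<^sup>2) - (\<Sum>i\<in>F0. (norm (u i))\<^sup>2)"
        using F pyth[of "F - F0"] by (simp add: sum_diff[of F F0 "\<lambda>i. (norm (u i))\<^sup>2"])
      also have "(\<Sum>i\<in>F. (norm (u i))\<^sup>2) \<le> s"
        by (rule finite_sum_le_has_sum[OF s F(1)]) auto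
      also have "s - (\<Sum>i\<in>F0. (norm (u i))\<^sup>2) \<le> (e/3)\<^sup>2"
        using F0(2) by (auto simp: dist_real_def)
      finally show ?thesis using e by (auto intro: power2_le_imp_le)
    qed
    have "dist (sum u F) (sum u F') < e" if "P F" "P F'" for F F'
      using near[OF that(1)] near[OF that(2)] e dist_triangle2[of "sum u F" "sum u F'" "sum u F0"]
      by linarith
    moreover have "eventually P (finite_subsets_at_top UNIV)"
      unfolding P_def eventually_finite_subsets_at_top using F0(1) by auto
    ultimately show ?thesis by blast
  qed
  then have "cauchy_filter (filtermap (sum u) (finite_subsets_at_top UNIV))"
    by (simp add: cauchy_filter_metric_filtermap)
  moreover have "complete (UNIV :: 'a set)"
    by (meson Cauchy_convergent UNIV_I complete_def convergent_def)
  ultimately obtain l where l: "(sum u \<longlongrightarrow> l) (finite_subsets_at_top UNIV)"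
    using complete_uniform[where S=UNIV] by (force simp add: filterlim_def)
  then show summ: "u summable_on UNIV" by (auto simp: summable_on_def has_sum_def)
  have l': "infsum u UNIV = l" using l by (intro infsumI) (simp add: has_sum_def)
  have "((\<lambda>F. (norm (sum u F))\<^sup>2) \<longlongrightarrow> (norm l)\<^sup>2) (finite_subsets_at_top UNIV)"
    by (intro tendsto_intros l)
  then have "((\<lambda>F. \<Sum>i\<in>F. (norm (u i))\<^sup>2) \<longlongrightarrow> (norm l)\<^sup>2) (finite_subsets_at_top UNIV)"
    by (rule Lim_transform_eventually)
       (auto intro!: eventually_finite_subsets_at_top_weakI simp: pyth)
  then show "((\<lambda>i. (norm (u i))\<^sup>2) has_sum (norm (infsum u UNIV))\<^sup>2) UNIV"
    by (simp add: has_sum_def l')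
qed

lemma has_sum_finite_sum:
  fixes f :: "'i \<Rightarrow> 'j \<Rightarrow> 'b::topological_comm_monoid_add"
  assumes "finite F" "\<And>m. m \<in> F \<Longrightarrow> (f m has_sum s m) U"
  shows "((\<lambda>j. \<Sum>m\<in>F. f m j) has_sum (\<Sum>m\<in>F. s m)) U"
  using assms by (induction F rule: finite_induct) (auto intro!: has_sum_add)

section \<open>Symmetric ranges of integers and sums of inverse squares\<close>

lemma int_annulus:
  "{m::int. int k < \<bar>m\<bar> \<and> \<bar>m\<bar> \<le> int n} = int ` {k<..n} \<union> (\<lambda>i. - int i) ` {k<..n}"
proof -
  have "m \<in> int ` {k<..n} \<union> (\<lambda>i. - int i) ` {k<..n}" if "int k < \<bar>m\<bar>" "\<bar>m\<bar> \<le> int n" for m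
    using that by (cases "m \<ge> 0") (auto intro!: image_eqI[where x="nat \<bar>m\<bar>"])
  then show ?thesis by auto
qed

lemma finite_int_annulus: "finite {m::int. int k < \<bar>m\<bar> \<and> \<bar>m\<bar> \<le> int n}"
  by (simp add: int_annulus)

lemma sum_annulus:
  "(\<Sum>m\<in>{m::int. int k < \<bar>m\<bar> \<and> \<bar>m\<bar> \<le> int n}. 1 / (of_int m)\<^sup>2)
    = 2 * (\<Sum>i\<in>{k<..n}. 1 / (real i)\<^sup>2)"
proof -
  have "int ` {k<..n} \<inter> (\<lambda>i. - int i) ` {k<..n} = {}" by auto
  then show ?thesis
    unfolding int_annulus by (simp add: sum.union_disjoint sum.reindex inj_on_def)
qed

lemma sum_inverse_squares_tail:
  assumes "k \<ge> 1" shows "(\<Sum>i\<in>{k<..n}. 1 / (real i)\<^sup>2) \<le> 1 / real k"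
proof (cases "k \<le> n")
  case True
  \<comment> \<open>The sharper bound telescopes:
    \<open>1/(n+1)^2 \<le> 1/n - 1/(n+1)\<close>.\<close>
  then have "(\<Sum>i\<in>{k<..n}. 1 / (real i)\<^sup>2) \<le> 1 / real k - 1 / real n"
  proof (induction n rule: dec_induct)
    case (step n)
    have "{k<..Suc n} = insert (Suc n) {k<..n}" using step(1) by auto
    then have "(\<Sum>i\<in>{k<..Suc n}. 1 / (real i)\<^sup>2) \<le> 1 / real k - 1 / real n + 1 / (real (Suc n))\<^sup>2"
      using step by simp
    also have "1 / (real (Suc n))\<^sup>2 \<le> 1 / real n - 1 / real (Suc n)"
    proof -
      have n: "real n > 0" using step assms by simp
      have "1 / real n - 1 / real (Suc n) = 1 / (real n * real (Suc n))"
        using n by (simp add: field_simps)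
      moreover have "1 / (real (Suc n))\<^sup>2 \<le> 1 / (real n * real (Suc n))"
        unfolding power2_eq_square using n by (intro divide_left_mono mult_right_mono) auto
      ultimately show ?thesis by simp
    qed
    finally show ?case by simp
  qed simp
  then show ?thesis by (smt (verit) divide_nonneg_nonneg of_nat_0_le_iff)
qed simp

lemma sum_inverse_squares_le: "(\<Sum>i\<in>{0<..n}. 1 / (real i)\<^sup>2) \<le> pi\<^sup>2 / 6"
proof -
  have "(\<Sum>i\<in>{0<..n}. 1 / (real i)\<^sup>2) = (\<Sum>i<n. 1 / (real i + 1)\<^sup>2)"
    by (rule sum.reindex_bij_witness[of _ Suc "\<lambda>i. i - 1"]) (auto simp: add.commute)
  also have "\<dots> \<le> (\<Sum>i. 1 / (real i + 1)\<^sup>2)"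
    by (rule sum_le_suminf) (use inverse_squares_sums in \<open>auto simp: sums_iff add.commute\<close>)
  also have "\<dots> = pi\<^sup>2 / 6" using inverse_squares_sums by (simp add: sums_iff add.commute)
  finally show ?thesis .
qed

text \<open>This turns unconditional sums over the integers into limits of symmetric partial
  sums.\<close>

lemma filterlim_int_balls:
  "filterlim (\<lambda>n. {m::int. \<bar>m\<bar> \<le> int n}) (finite_subsets_at_top UNIV) sequentially"
  unfolding filterlim_finite_subsets_at_top
proof (intro allI impI)
  fix X :: "int set" assume "finite X \<and> X \<subseteq> UNIV"
  then have X: "finite X" by simp
  define N where "N = nat (\<Sum>m\<in>X. \<bar>m\<bar>)"
  have "\<bar>m\<bar> \<le> int N" if "m \<in> X" for m
    using member_le_sum[OF that, of abs] X by (simp add: N_def sum_nonneg)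
  moreover have "finite {m::int. \<bar>m\<bar> \<le> int n}" for n
    by (rule finite_subset[of _ "{- int n..int n}"]) auto
  ultimately show "\<forall>\<^sub>F n in sequentially. finite {m::int. \<bar>m\<bar> \<le> int n} \<and> X \<subseteq> {m. \<bar>m\<bar> \<le> int n} \<and> {m. \<bar>m\<bar> \<le> int n} \<subseteq> UNIV"
    by (intro eventually_sequentiallyI[of N]) force
qed

subsection \<open>Complex Hilbert spaces\<close>

lemma scaleC_zero_right [simp]: "c *\<^sub>C (0::'a::complex_hilbert_space) = 0"
  using scaleC_add_right[of c 0 "0::'a"] by simp

lemma scaleC_minus_right: "c *\<^sub>C (- x) = - (c *\<^sub>C (x::'a::complex_hilbert_space))"
  using scaleC_add_right[of c x "- x"] by (simp add: eq_neg_iff_add_eq_0 add.commute)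

lemma scaleC_diff_right: "c *\<^sub>C (x - y) = c *\<^sub>C x - c *\<^sub>C (y::'a::complex_hilbert_space)"
  using scaleC_add_right[of c x "- y"] by (simp add: scaleC_minus_right)

lemma scaleC_scaleR: "c *\<^sub>C (r *\<^sub>R x) = r *\<^sub>R (c *\<^sub>C (x::'a::complex_hilbert_space))"
  by (simp flip: scaleC_of_real add: scaleC_scaleC mult.commute)

lemma scaleC_of_int: "of_int m *\<^sub>C x = of_int m *\<^sub>R (x::'a::complex_hilbert_space)"
  by (metis of_real_of_int_eq scaleC_of_real)

lemma cinner_scaleC_left: "cinner (c *\<^sub>C x) y = cnj c * cinner x (y::'a::complex_hilbert_space)"
  by (metis cinner_commute cinner_scaleC_right complex_cnj_mult)

lemma norm_scaleC: "norm (c *\<^sub>C (x::'a::complex_hilbert_space)) = cmod c * norm x"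
proof -
  have "(norm (c *\<^sub>C x))\<^sup>2 = Re (cnj c * c * cinner x x)"
    by (simp add: power2_norm_eq_inner inner_eq_Re_cinner cinner_scaleC_left cinner_scaleC_right
        mult_ac)
  also have "cnj c * c = complex_of_real ((cmod c)\<^sup>2)"
    by (metis complex_norm_square mult.commute)
  also have "Re (complex_of_real ((cmod c)\<^sup>2) * cinner x x) = (cmod c * norm x)\<^sup>2"
    by (simp add: power2_norm_eq_inner inner_eq_Re_cinner power_mult_distrib flip: of_real_power)
  finally show ?thesis by (simp add: power2_eq_iff_nonneg)
qed

lemma bounded_linear_scaleC: "bounded_linear ((*\<^sub>C) c :: 'a::complex_hilbert_space \<Rightarrow> 'a)"
  by (rule bounded_linear_intro[where K="cmod c"])
     (simp_all add: scaleC_add_right scaleC_scaleR norm_scaleC mult.commute)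

lemma Im_cinner: "Im (cinner x y) = inner (\<i> *\<^sub>C x) (y::'a::complex_hilbert_space)"
  by (simp add: inner_eq_Re_cinner cinner_scaleC_left)

lemma complex_subspace_imp_subspace: "complex_subspace S \<Longrightarrow> subspace S"
  unfolding complex_subspace_def subspace_def by (metis scaleC_of_real)

text \<open>A complex subspace contains \<open>\<i> h\<close> along with \<open>h\<close>, and the
  imaginary part of \<open>cinner h v\<close> is the real inner product of \<open>\<i> h\<close> and
  \<open>v\<close>. Projections can therefore be characterized by the real inner product.\<close>

lemma cinner_orthogonal_iff:
  assumes "complex_subspace S"
  shows "(\<forall>h\<in>S. cinner h v = 0) \<longleftrightarrow> (\<forall>h\<in>S. inner h v = 0)"
  using assms by (auto simp: complex_subspace_def complex_eq_iff Im_cinner inner_eq_Re_cinner)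

lemma orth_proj_eqI:
  assumes S: "complex_subspace S" and p: "p \<in> S" and o: "\<And>h. h \<in> S \<Longrightarrow> inner h (x - p) = 0"
  shows "orth_proj S x = p"
  unfolding orth_proj_def
proof (rule the_equality)
  show "p \<in> S \<and> (\<forall>h\<in>S. cinner h (x - p) = 0)"
    using p o cinner_orthogonal_iff[OF S] by blast
next
  fix q assume "q \<in> S \<and> (\<forall>h\<in>S. cinner h (x - q) = 0)"
  then have q: "q \<in> S" "\<And>h. h \<in> S \<Longrightarrow> inner h (x - q) = 0"
    using cinner_orthogonal_iff[OF S] by blast+
  have "q - p \<in> S" using S p q by (metis complex_subspace_imp_subspace subspace_diff)
  then have "inner (q - p) (x - p) = 0" "inner (q - p) (x - q) = 0" using o q by auto
  then have "inner (q - p) (q - p) = 0" by (simp add: inner_diff_right)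
  then show "q = p" by simp
qed

subsection \<open>Self-adjoint operators with integer spectrum\<close>

locale integer_spectrum =
  fixes D :: "'a::complex_hilbert_space \<rightharpoonup> 'a"
  assumes self_adj: "self_adjoint D" and spectrum: "operator_spectrum D \<subseteq> \<int>"
begin

abbreviation A :: "'a \<Rightarrow> 'a" where "A x \<equiv> the (D x)"

abbreviation H :: "int \<Rightarrow> 'a set" where "H m \<equiv> eigenspace D m"

text \<open>The resolvent of \<open>D\<close> at a real point, written as in
  \<open>resolvent_set\<close>; being total, it is meaningful only where that point lies in the
  resolvent set.\<close>

definition R :: "real \<Rightarrow> 'a \<Rightarrow> 'a" where
  "R l = inv_into (dom D) (\<lambda>x. A x - complex_of_real l *\<^sub>C x)"

lemma complex_subspace_dom: "complex_subspace (dom D)"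
  and A_add: "x \<in> dom D \<Longrightarrow> y \<in> dom D \<Longrightarrow> A (x + y) = A x + A y"
  and A_scaleC: "x \<in> dom D \<Longrightarrow> A (c *\<^sub>C x) = c *\<^sub>C A x"
  and dense_dom: "closure (dom D) = UNIV"
  and adjoint_eq: "adjoint_operator D = D"
  using self_adj unfolding self_adjoint_def linear_operator_def by blast+

lemma subspace_dom: "subspace (dom D)"
  by (rule complex_subspace_imp_subspace[OF complex_subspace_dom])

lemmas dom_intros = subspace_add[OF subspace_dom] subspace_diff[OF subspace_dom]
  subspace_scale[OF subspace_dom]

lemma A_scaleR: "x \<in> dom D \<Longrightarrow> A (r *\<^sub>R x) = r *\<^sub>R A x"
  by (metis A_scaleC scaleC_of_real)

lemma A_diff: "x \<in> dom D \<Longrightarrow> y \<in> dom D \<Longrightarrow> A (x - y) = A x - A y"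
  using A_add[of "x - y" y] by (simp add: dom_intros)

text \<open>Density of the domain makes the vector in the definition of the adjoint unique, so the
  definite description can be evaluated; \<open>D\<close> being its own adjoint, that vector is
  \<open>A y\<close>.\<close>

lemma A_symmetric:
  assumes x: "x \<in> dom D" and y: "y \<in> dom D"
  shows "inner (A y) x = inner y (A x)"
proof -
  let ?Q = "\<lambda>z. \<forall>x\<in>dom D. cinner y (A x) = cinner z x"
  have "adjoint_operator D y = D y" by (simp add: adjoint_eq)
  with y have ex: "\<exists>z. ?Q z" and D: "D y = Some (THE z. ?Q z)"
    unfolding adjoint_operator_def by (auto split: if_splits)
  then obtain z where z: "?Q z" by blast
  have "(THE z. ?Q z) = z"
  proof (rule the_equality)
    fix w assume w: "?Q w"
    have "inner (w - z) x = 0" if "x \<in> dom D" for x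
      using bspec[OF w that] bspec[OF z that] unfolding inner_diff_left unfolding inner_eq_Re_cinner by simp
    then have "dom D \<subseteq> {x. inner (w - z) x = 0}" by blast
    then have "closure (dom D) \<subseteq> {x. inner (w - z) x = 0}"
      by (rule closure_minimal) (intro closed_Collect_eq continuous_intros)
    then have "inner (w - z) (w - z) = 0" unfolding dense_dom by blast
    then show "w = z" by simp
  qed (rule z)
  then have "A y = z" by (simp add: D)
  then show ?thesis using z x by (simp add: inner_eq_Re_cinner)
qed

section \<open>Resolvents at non-integer real points\<close>

context
  fixes l :: real
  assumes l: "l \<notin> \<int>"
begin

lemma R_resolvent:
  "bij_betw (\<lambda>x. A x - complex_of_real l *\<^sub>C x) (dom D) UNIV" "bounded_linear (R l)"
proof -
  have "complex_of_real l \<notin> \<int>"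
    using l by (metis Ints_cases Ints_of_int of_real_eq_iff of_real_of_int_eq)
  then have "complex_of_real l \<in> resolvent_set D"
    using spectrum unfolding operator_spectrum_def by blast
  then show "bij_betw (\<lambda>x. A x - complex_of_real l *\<^sub>C x) (dom D) UNIV" "bounded_linear (R l)"
    unfolding resolvent_set_def R_def by auto
qed

lemma R_dom: "R l x \<in> dom D"
  unfolding R_def by (rule inv_into_into) (use R_resolvent(1) in \<open>auto simp: bij_betw_def\<close>)

lemma A_R: "A (R l x) = x + l *\<^sub>R R l x"
proof -
  have "A (R l x) - complex_of_real l *\<^sub>C R l x = x"
    unfolding R_def
    by (rule f_inv_into_f[of x "\<lambda>x. A x - complex_of_real l *\<^sub>C x" "dom D"])
      (use R_resolvent(1) in \<open>auto simp: bij_betw_def\<close>)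
  then show ?thesis by (simp add: scaleC_of_real algebra_simps)
qed

lemma R_eqI: "x \<in> dom D \<Longrightarrow> A x - l *\<^sub>R x = y \<Longrightarrow> R l y = x"
  unfolding R_def
  using inv_into_f_f[of "\<lambda>x. A x - complex_of_real l *\<^sub>C x" "dom D" x] R_resolvent(1)
  by (simp add: bij_betw_def scaleC_of_real)

lemma R_symmetric: "inner (R l x) y = inner x (R l y)"
  using A_symmetric[of "R l x" "R l y"] by (simp add: R_dom A_R inner_add inner_commute)

end

text \<open>One bounded resolvent suffices: \<open>u n = R (1/2) (A (u n) - u n / 2)\<close> passes
  to the limit.\<close>

lemma A_closed:
  assumes d: "\<And>n. u n \<in> dom D" and u: "u \<longlonglongrightarrow> x" and Au: "(\<lambda>n. A (u n)) \<longlonglongrightarrow> y"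
  shows "x \<in> dom D" "A x = y"
proof -
  have l: "(1/2::real) \<notin> \<int>"
    using fraction_not_in_Ints[of 2 1] by simp
  interpret R: bounded_linear "R (1/2)" by (rule R_resolvent(2)[OF l])
  have "(\<lambda>n. R (1/2) (A (u n) - (1/2) *\<^sub>R u n)) \<longlonglongrightarrow> R (1/2) (y - (1/2) *\<^sub>R x)"
    by (intro R.tendsto tendsto_intros u Au)
  moreover have "R (1/2) (A (u n) - (1/2) *\<^sub>R u n) = u n" for n
    by (rule R_eqI[OF l d refl])
  ultimately have eq: "R (1/2) (y - (1/2) *\<^sub>R x) = x" using u by (auto intro: LIMSEQ_unique)
  show "x \<in> dom D" "A x = y"
    using R_dom[OF l, of "y - (1/2) *\<^sub>R x"] A_R[OF l, of "y - (1/2) *\<^sub>R x"] by (simp_all add: eq)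
qed

lemma R_commute:
  assumes l: "l \<notin> \<int>" and k: "k \<notin> \<int>"
  shows "R l (R k x) = R k (R l x)"
proof -
  interpret Rk: bounded_linear "R k" by (rule R_resolvent(2)[OF k])
  define u z where "u = R k x" and "z = R l u"
  have u: "u \<in> dom D" "A u = x + k *\<^sub>R u" and z: "z \<in> dom D" "A z = u + l *\<^sub>R z"
    by (simp_all add: u_def z_def R_dom A_R l k)
  \<comment> \<open>The resolvent identity predicts this value for \<open>R l x\<close>.\<close>
  define w where "w = u + (l - k) *\<^sub>R z"
  have w: "w \<in> dom D" unfolding w_def by (intro dom_intros u z)
  have "A w = A u + (l - k) *\<^sub>R A z" unfolding w_def by (simp add: u z dom_intros A_add A_scaleR)
  then have "R l x = w"
    by (intro R_eqI[OF l w]) (simp add: u z w_def algebra_simps)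
  moreover have "R k w = z"
    by (rule R_eqI[OF k]) (use u z in \<open>simp_all add: w_def algebra_simps\<close>)
  ultimately show ?thesis by (simp add: u_def z_def)
qed

lemma not_Ints_between: "real_of_int m < x \<Longrightarrow> x < real_of_int m + 1 \<Longrightarrow> x \<notin> \<int>"
proof
  assume a: "real_of_int m < x" "x < real_of_int m + 1" and "x \<in> \<int>"
  then obtain k where "x = of_int k" by (auto elim: Ints_cases)
  then have "m < k" "k < m + 1" using a by linarith+
  then show False by simp
qed

text \<open>The integers keep distance at least \<open>e\<close> from \<open>m + e\<close>. For
  \<open>\<bar>r\<bar> < e\<close> the point \<open>m + e + r\<close> stays between \<open>m\<close>
  and \<open>m + 1\<close>, and its resolvent undoes \<open>1 - r R (m + e)\<close> up to the factor
  \<open>R (m + e)\<close>.\<close>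

lemma R_bound:
  assumes e: "0 < e" "e \<le> 1/2"
  shows "e * norm (R (of_int m + e) x) \<le> norm x"
proof (rule symmetric_norm_le[where M=UNIV])
  have n: "of_int m + e \<notin> \<int>" by (rule not_Ints_between[of m]) (use e in auto)
  show "bounded_linear (R (of_int m + e))" by (rule R_resolvent(2)[OF n])
  show "inner (R (of_int m + e) x) y = inner x (R (of_int m + e) y)" for x y
    by (rule R_symmetric[OF n])
  fix r :: real assume r: "\<bar>r\<bar> < e"
  have n': "of_int m + e + r \<notin> \<int>" by (rule not_Ints_between[of m]) (use e r in auto)
  interpret R: bounded_linear "R (of_int m + e + r)" by (rule R_resolvent(2)[OF n'])
  obtain K where K: "\<And>x. norm (R (of_int m + e + r) x) \<le> norm x * K" using R.bounded by blast
  have "R (of_int m + e + r) (x - r *\<^sub>R R (of_int m + e) x) = R (of_int m + e) x" for x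
    by (rule R_eqI[OF n' R_dom[OF n]]) (simp add: A_R[OF n] scaleR_add_left)
  then show "\<exists>K. \<forall>x\<in>UNIV. norm (R (of_int m + e) x) \<le> K * norm (x - r *\<^sub>R R (of_int m + e) x)"
    using K by (metis mult.commute)
qed (use e in auto)

section \<open>The gap in the spectrum of \<open>(D - m)^2\<close> and the eigenprojections\<close>

definition S :: "int \<Rightarrow> 'a \<Rightarrow> 'a" where "S m x = A x - of_int m *\<^sub>R x"

lemma S_add: "x \<in> dom D \<Longrightarrow> y \<in> dom D \<Longrightarrow> S m (x + y) = S m x + S m y"
  and S_diff: "x \<in> dom D \<Longrightarrow> y \<in> dom D \<Longrightarrow> S m (x - y) = S m x - S m y"
  and S_scaleR: "x \<in> dom D \<Longrightarrow> S m (r *\<^sub>R x) = r *\<^sub>R S m x"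
  by (simp_all add: S_def A_add A_diff A_scaleR algebra_simps)

lemma S_symmetric: "x \<in> dom D \<Longrightarrow> y \<in> dom D \<Longrightarrow> inner (S m x) y = inner x (S m y)"
  using A_symmetric by (simp add: S_def inner_diff)

lemma not_Ints_pm:
  fixes b :: real
  assumes "0 < b" "b < 1"
  shows "of_int m + b \<notin> \<int>" "of_int m - b \<notin> \<int>"
proof -
  show "of_int m + b \<notin> \<int>" using assms by (intro not_Ints_between[of m]) auto
  show "of_int m - b \<notin> \<int>" using assms by (intro not_Ints_between[of "m - 1"]) auto
qed

text \<open>Since \<open>(D - m)^2 - b^2 = (D - m + b) (D - m - b)\<close>, the resolvents at
  \<open>m + b\<close> and \<open>m - b\<close> compose to its inverse. \<open>RR_eqI\<close> is the
  other half of this inversion.\<close>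

lemma RR_eq:
  fixes m :: int and x :: 'a
  assumes b: "0 < b" "b < 1"
  defines "z \<equiv> R (of_int m + b) (R (of_int m - b) x)"
  shows "z \<in> dom D" "S m z \<in> dom D" "S m (S m z) - b\<^sup>2 *\<^sub>R z = x"
proof -
  note n = not_Ints_pm[OF b, of m]
  show z: "z \<in> dom D" unfolding z_def by (rule R_dom[OF n(1)])
  have Sz: "S m z = R (of_int m - b) x + b *\<^sub>R z"
    unfolding S_def using A_R[OF n(1), of "R (of_int m - b) x"] by (simp add: z_def algebra_simps)
  show "S m z \<in> dom D" unfolding Sz by (intro dom_intros z R_dom[OF n(2)])
  have "S m (S m z) = S m (R (of_int m - b) x) + b *\<^sub>R S m z"
    by (subst Sz) (simp add: S_add S_scaleR dom_intros z R_dom[OF n(2)])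
  also have "S m (R (of_int m - b) x) = x - b *\<^sub>R R (of_int m - b) x"
    unfolding S_def A_R[OF n(2)] by (simp add: algebra_simps)
  also have "b *\<^sub>R S m z = b *\<^sub>R (R (of_int m - b) x + b *\<^sub>R z)" by (simp add: Sz)
  finally have "S m (S m z) = x - b *\<^sub>R R (of_int m - b) x + b *\<^sub>R (R (of_int m - b) x + b *\<^sub>R z)" .
  then show "S m (S m z) - b\<^sup>2 *\<^sub>R z = x"
    using Sz by (simp add: algebra_simps power2_eq_square)
qed

lemma RR_eqI:
  assumes b: "0 < b" "b < 1" and z: "z \<in> dom D" "S m z \<in> dom D"
    and eq: "S m (S m z) - b\<^sup>2 *\<^sub>R z = x"
  shows "R (of_int m + b) (R (of_int m - b) x) = z"
proof -
  note n = not_Ints_pm[OF b, of m]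
  have "R (of_int m - b) x = S m z - b *\<^sub>R z"
  proof (rule R_eqI[OF n(2)])
    show "S m z - b *\<^sub>R z \<in> dom D" by (intro dom_intros z)
    have "S m (S m z - b *\<^sub>R z) + b *\<^sub>R (S m z - b *\<^sub>R z) = x"
      using eq by (simp add: S_diff S_scaleR dom_intros z power2_eq_square algebra_simps)
    then show "A (S m z - b *\<^sub>R z) - (of_int m - b) *\<^sub>R (S m z - b *\<^sub>R z) = x"
      unfolding S_def[of m "S m z - b *\<^sub>R z"] by (simp add: algebra_simps)
  qed
  then show ?thesis
    by (intro R_eqI[OF n(1)] z) (simp add: S_def algebra_simps)
qed

text \<open>Spectrally, \<open>(D - m)\<^sup>2\<close> has no spectrum in \<open>]0, 1[\<close>, so \<open>B\<close>, the inverse of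
  \<open>(D - m)\<^sup>2 - 1/2\<close>, has norm at most \<open>2\<close>.\<close>

lemma norm_S_le_norm_SS:
  assumes z: "z \<in> dom D" "S m z \<in> dom D"
  shows "norm (S m z) \<le> norm (S m (S m z))"
proof -
  \<comment> \<open>\<open>b^2\<close> is the midpoint of the gap, at distance \<open>1/2\<close>
    from both ends.\<close>
  define b where "b = sqrt (1/2)"
  have b: "0 < b" "b < 1" "b\<^sup>2 = 1/2" by (auto simp: b_def real_sqrt_lt_1_iff)
  define B where "B x = R (of_int m + b) (R (of_int m - b) x)" for x
  note n = not_Ints_pm[OF b(1,2), of m]
  note Bz = RR_eq[OF b(1,2), of m, folded B_def]
  have "(1/2) * norm (B x) \<le> norm x" for x
  proof (rule symmetric_norm_le[where M=UNIV])
    show "bounded_linear B" unfolding B_def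
      by (rule bounded_linear_compose[OF R_resolvent(2)[OF n(1)] R_resolvent(2)[OF n(2)]])
    show "inner (B x) y = inner x (B y)" for x y
      unfolding B_def using R_commute[OF n] R_symmetric[OF n(1)] R_symmetric[OF n(2)] by simp
    fix r :: real assume r: "\<bar>r\<bar> < 1/2"
    \<comment> \<open>Shifting \<open>(D - m)^2 - 1/2\<close> by \<open>- r\<close> replaces
      \<open>b\<close> by \<open>c\<close>, which stays in the gap for
      \<open>\<bar>r\<bar> < 1/2\<close>.\<close>
    define c where "c = sqrt (1/2 + r)"
    have c: "0 < c" "c < 1" "c\<^sup>2 = 1/2 + r" using r by (auto simp: c_def real_sqrt_lt_1_iff)
    note n' = not_Ints_pm[OF c(1,2), of m]
    obtain K where K: "\<And>x. norm (R (of_int m + c) (R (of_int m - c) x)) \<le> norm x * K"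
      using bounded_linear.bounded[OF bounded_linear_compose[OF R_resolvent(2)[OF n'(1)] R_resolvent(2)[OF n'(2)]]]
      by blast
    have "R (of_int m + c) (R (of_int m - c) (x - r *\<^sub>R B x)) = B x" for x
      by (rule RR_eqI[OF c(1,2) Bz(1,2)]) (use Bz(3)[of x] b(3) c(3) in \<open>simp add: algebra_simps\<close>)
    then show "\<exists>K. \<forall>x\<in>UNIV. norm (B x) \<le> K * norm (x - r *\<^sub>R B x)"
      using K by (metis mult.commute)
  qed auto
  note this[of "S m (S m z) - b\<^sup>2 *\<^sub>R z"]
  moreover have "B (S m (S m z) - b\<^sup>2 *\<^sub>R z) = z"
    unfolding B_def by (rule RR_eqI[OF b(1,2) z refl])
  ultimately have "(1/2) * norm z \<le> norm (S m (S m z) - (1/2) *\<^sub>R z)" using b(3) by simp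
  then have "((1/2) * norm z)\<^sup>2 \<le> (norm (S m (S m z) - (1/2) *\<^sub>R z))\<^sup>2" by (rule power_mono) simp
  \<comment> \<open>The last term cancels against the left-hand side, which leaves the
    claim.\<close>
  also have "\<dots> = (norm (S m (S m z)))\<^sup>2 - inner (S m (S m z)) z + ((1/2) * norm z)\<^sup>2"
    unfolding power_mult_distrib power2_norm_eq_inner
    by (simp add: inner_diff inner_commute power_divide algebra_simps)
  also have "inner (S m (S m z)) z = (norm (S m z))\<^sup>2"
    using S_symmetric[OF z(2,1)] by (simp add: power2_norm_eq_inner)
  finally have "(norm (S m z))\<^sup>2 \<le> (norm (S m (S m z)))\<^sup>2" by simp
  then show ?thesis by (rule power2_le_imp_le) simp
qed

lemma mem_H: "x \<in> H m \<longleftrightarrow> x \<in> dom D \<and> S m x = 0"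
  by (auto simp: eigenspace_def S_def scaleC_of_int)

lemma complex_subspace_H: "complex_subspace (H m)"
  using complex_subspace_dom
  by (auto simp: complex_subspace_def eigenspace_def A_add A_scaleC scaleC_add_right scaleC_scaleC
      mult.commute) (use A_scaleR[of 0 0] complex_subspace_dom in \<open>simp add: complex_subspace_def\<close>)

text \<open>The projection onto \<open>H m\<close> is the strong limit of \<open>- e R (m + e)\<close> as \<open>e\<close> tends to \<open>0\<close>;
  \<open>norm_S_le_norm_SS\<close> makes this family Cauchy.\<close>

lemma exists_eigenprojection:
  obtains p where "p \<in> H m" "\<And>h. h \<in> H m \<Longrightarrow> inner h (y - p) = 0"
    "y \<in> dom D \<Longrightarrow> norm (y - p) \<le> norm (S m y)"
proof -
  \<comment> \<open>The offset \<open>2\<close> keeps \<open>e n \<le> 1/2\<close>, as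
    \<open>R_bound\<close> requires.\<close>
  define e where "e n = 1 / (real n + 2)" for n
  have e: "0 < e n" "e n \<le> 1/2" for n by (auto simp: e_def field_simps)
  have e0: "e \<longlonglongrightarrow> 0" 
    unfolding e_def using LIMSEQ_ignore_initial_segment[OF lim_1_over_n[where 'a=real], of 2] by (simp add: add.commute)
  have ne: "of_int m + e n \<notin> \<int>" for n
    by (rule not_Ints_between[of m]) (use e[of n] in auto)
  define v where "v n = R (of_int m + e n) y" for n
  define u where "u n = - (e n *\<^sub>R v n)" for n
  have v: "v n \<in> dom D" for n unfolding v_def by (rule R_dom[OF ne])
  have u: "u n \<in> dom D" for n
    using dom_intros(3)[OF v, of "- e n" n] by (simp add: u_def)
  have Sv: "S m (v n) = y - u n" for n
    by (simp add: S_def v_def A_R[OF ne] u_def algebra_simps)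
  have Su: "S m (u n) = e n *\<^sub>R (u n - y)" for n
  proof -
    have "u n = (- e n) *\<^sub>R v n" by (simp add: u_def)
    then have "S m (u n) = (- e n) *\<^sub>R S m (v n)" by (simp only: S_scaleR[OF v])
    then show ?thesis by (simp add: Sv algebra_simps)
  qed
  have ub: "norm (u n) \<le> norm y" for n
    using R_bound[OF e, of n m y] e[of n] by (simp add: u_def v_def)
  have Sub: "norm (S m (u n)) \<le> e n * (2 * norm y)" for n
    unfolding Su using e[of n] ub[of n] norm_triangle_ineq4[of "u n" y] by (simp add: mult_left_mono)
  have Su0: "(\<lambda>n. S m (u n)) \<longlonglongrightarrow> 0"
    by (rule Lim_null_comparison[OF always_eventually tendsto_mult_left_zero[OF e0]])
       (use Sub in blast)
  \<comment> \<open>In \<open>S m (v k - v n)\<close> the vector \<open>y\<close> cancels and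
    \<open>u n - u k\<close> remains, to which \<open>S m\<close> applies once more.\<close>
  have "norm (u n - u k) \<le> norm (S m (u n) - S m (u k))" for n k
    using norm_S_le_norm_SS[of "v k - v n" m]
    by (simp add: S_diff v u dom_intros Sv)
  moreover have "Cauchy (\<lambda>n. S m (u n))" using Su0 by (intro LIMSEQ_imp_Cauchy)
  ultimately have "Cauchy u" unfolding Cauchy_def dist_norm by (meson order.strict_trans1)
  then obtain p where p: "u \<longlonglongrightarrow> p" using Cauchy_convergent convergent_def by blast
  have "(\<lambda>n. S m (u n) + of_int m *\<^sub>R u n) \<longlonglongrightarrow> 0 + of_int m *\<^sub>R p"
    by (intro tendsto_intros Su0 p)
  then have "(\<lambda>n. A (u n)) \<longlonglongrightarrow> of_int m *\<^sub>R p" by (simp add: S_def)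
  from A_closed[OF u p this] have pH: "p \<in> H m" by (simp add: mem_H S_def)
  have "inner h (y - p) = 0" if h: "h \<in> H m" for h
  proof -
    have "inner h (y - u n) = 0" for n
      using S_symmetric[OF _ v, of h m n] h by (simp add: mem_H Sv)
    moreover have "(\<lambda>n. inner h (y - u n)) \<longlonglongrightarrow> inner h (y - p)" by (intro tendsto_intros p)
    ultimately show ?thesis by (simp add: LIMSEQ_const_iff)
  qed
  moreover have "norm (y - p) \<le> norm (S m y)" if y: "y \<in> dom D"
  proof (rule LIMSEQ_le)
    show "(\<lambda>n. norm (y - u n)) \<longlonglongrightarrow> norm (y - p)" by (intro tendsto_intros p)
    have "(\<lambda>n. norm (S m y - S m (u n))) \<longlonglongrightarrow> norm (S m y - 0)" by (intro tendsto_intros Su0)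
    then show "(\<lambda>n. norm (S m y - S m (u n))) \<longlonglongrightarrow> norm (S m y)" by simp
    \<comment> \<open>Here \<open>y - u n\<close> is \<open>S m (v n)\<close>, so the gap estimate
      applies to \<open>v n\<close>.\<close>
    show "\<exists>N. \<forall>n\<ge>N. norm (y - u n) \<le> norm (S m y - S m (u n))"
      using norm_S_le_norm_SS[OF v, of m] by (simp add: Sv S_diff y u dom_intros)
  qed
  ultimately show ?thesis using that pH by blast
qed

section \<open>Projections onto the eigenspaces and their completeness\<close>

definition P :: "int \<Rightarrow> 'a \<Rightarrow> 'a" where "P m = orth_proj (H m)"

lemma P_eqI: "p \<in> H m \<Longrightarrow> (\<And>h. h \<in> H m \<Longrightarrow> inner h (x - p) = 0) \<Longrightarrow> P m x = p"
  unfolding P_def by (rule orth_proj_eqI[OF complex_subspace_H])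

lemma P_mem: "P m x \<in> H m" and P_orth: "h \<in> H m \<Longrightarrow> inner h (x - P m x) = 0"
  by (metis P_eqI exists_eigenprojection)+

lemma norm_le_norm_S:
  assumes "y \<in> dom D" "\<And>h. h \<in> H m \<Longrightarrow> inner h y = 0"
  shows "norm y \<le> norm (S m y)"
proof -
  obtain p where p: "p \<in> H m" "\<And>h. h \<in> H m \<Longrightarrow> inner h (y - p) = 0" "norm (y - p) \<le> norm (S m y)"
    using exists_eigenprojection[of m y] assms(1) by metis
  have "inner p p = 0" using p(1) p(2)[OF p(1)] assms(2)[OF p(1)] by (simp add: inner_diff_right)
  then show ?thesis using p(3) by simp
qed

text \<open>On the common complement \<open>M\<close> no real \<open>r\<close> is an obstacle:
  resolvents handle non-integer \<open>1/2 + r\<close>, and \<open>norm_le_norm_S\<close> handles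
  integers. So \<open>symmetric_norm_le\<close> holds for every \<open>d\<close>, which forces
  \<open>R (1/2) x = 0\<close>.\<close>

lemma orthogonal_to_eigenspaces_eq_0:
  assumes x: "\<And>m h. h \<in> H m \<Longrightarrow> inner h x = 0"
  shows "x = 0"
proof -
  define M where "M = {x. \<forall>m. \<forall>h\<in>H m. inner h x = 0}"
  have l: "(1/2::real) \<notin> \<int>" using fraction_not_in_Ints[of 2 1] by simp
  have inv: "R (1/2) x \<in> M" if "x \<in> M" for x
    unfolding M_def
  proof (intro CollectI allI ballI)
    fix m h assume h: "h \<in> H m"
    have "(of_int m - 1/2) * inner h (R (1/2) x) = inner h x"
      using A_symmetric[OF R_dom[OF l], of h x] h
      by (simp add: A_R[OF l] mem_H S_def inner_add_right algebra_simps)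
    moreover have "real_of_int m \<noteq> 1/2" using l by (metis Ints_of_int)
    ultimately show "inner h (R (1/2) x) = 0" using that h by (auto simp: M_def)
  qed
  have b: "d * norm (R (1/2) x) \<le> norm x" if d: "d > 0" for d
  proof (rule symmetric_norm_le[where M=M, OF R_resolvent(2)[OF l] _ inv _ d])
    show "subspace M" by (auto simp: subspace_def M_def inner_add_right)
    show "inner (R (1/2) x) y = inner x (R (1/2) y)" for x y by (rule R_symmetric[OF l])
    show "x \<in> M" using x by (auto simp: M_def)
    fix r :: real
    show "\<exists>K. \<forall>x\<in>M. norm (R (1/2) x) \<le> K * norm (x - r *\<^sub>R R (1/2) x)"
    proof (cases "1/2 + r \<in> \<int>")
      case True
      then obtain m where m: "1/2 + r = of_int m" by (auto elim: Ints_cases)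
      have "norm (R (1/2) x) \<le> 1 * norm (x - r *\<^sub>R R (1/2) x)" if "x \<in> M" for x
      proof -
        have "x - r *\<^sub>R R (1/2) x = S m (R (1/2) x)"
          by (simp add: S_def A_R[OF l] algebra_simps flip: m)
        then show ?thesis
          using norm_le_norm_S[OF R_dom[OF l], of m x] inv[OF that] by (simp add: M_def)
      qed
      then show ?thesis by blast
    next
      case False
      interpret R: bounded_linear "R (1/2 + r)" by (rule R_resolvent(2)[OF False])
      obtain K where K: "\<And>x. norm (R (1/2 + r) x) \<le> norm x * K" using R.bounded by blast
      have "R (1/2 + r) (x - r *\<^sub>R R (1/2) x) = R (1/2) x" for x
        by (rule R_eqI[OF False R_dom[OF l]]) (simp add: A_R[OF l] scaleR_add_left)
      then show ?thesis using K by (metis mult.commute)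
    qed
  qed
  have "R (1/2) x = 0"
  proof (rule ccontr)
    assume "R (1/2) x \<noteq> 0"
    \<comment> \<open>This \<open>d\<close> turns the bound into
      \<open>norm x + 1 \<le> norm x\<close>.\<close>
    then show False using b[of "(norm x + 1) / norm (R (1/2) x)"] by (simp add: add_nonneg_pos)
  qed
  then show ?thesis using A_R[OF l, of x] A_scaleR[OF R_dom[OF l], of 0 x] by simp
qed

lemma H_orth:
  assumes "i \<noteq> j" "x \<in> H i" "y \<in> H j" shows "inner x y = 0"
proof -
  have "of_int i * inner x y = of_int j * inner x y"
    using A_symmetric[of y x] assms(2,3) by (simp add: mem_H S_def)
  then show ?thesis using assms(1) by simp
qed

lemma zero_mem_H: "0 \<in> H m"
  using complex_subspace_H by (auto simp: complex_subspace_def)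

lemma P_of_H: "h \<in> H n \<Longrightarrow> P m h = (if m = n then h else 0)"
  by (cases "m = n") (auto intro!: P_eqI zero_mem_H intro: H_orth)

lemma inner_P_right: "h \<in> H m \<Longrightarrow> inner h (P m x) = inner h x"
  using P_orth[of h m x] by (simp add: inner_diff_right)

lemma P_scaleC: "P m (c *\<^sub>C x) = c *\<^sub>C P m x"
proof (rule P_eqI)
  show "c *\<^sub>C P m x \<in> H m" using complex_subspace_H P_mem by (auto simp: complex_subspace_def)
  fix h assume "h \<in> H m"
  then have "cinner h (x - P m x) = 0"
    using cinner_orthogonal_iff[OF complex_subspace_H] P_orth by blast
  then show "inner h (c *\<^sub>C x - c *\<^sub>C P m x) = 0"
    by (simp add: inner_eq_Re_cinner cinner_scaleC_right flip: scaleC_diff_right)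
qed

lemma norm_P_le: "norm (P m x) \<le> norm x"
proof -
  have "(norm (P m x))\<^sup>2 = inner (P m x) x"
    using inner_P_right[OF P_mem] by (simp add: power2_norm_eq_inner)
  also have "\<dots> \<le> norm (P m x) * norm x" by (rule norm_cauchy_schwarz)
  finally show ?thesis by (cases "P m x = 0") (simp_all add: power2_eq_square)
qed

lemma bounded_linear_P: "bounded_linear (P m)"
proof (rule bounded_linear_intro[where K=1])
  have sub: "subspace (H m)" by (rule complex_subspace_imp_subspace[OF complex_subspace_H])
  show "P m (x + y) = P m x + P m y" for x y
    by (rule P_eqI) (simp_all add: subspace_add[OF sub] P_mem inner_diff_right inner_add_right inner_P_right)
  show "P m (r *\<^sub>R x) = r *\<^sub>R P m x" for r x
    by (simp add: P_scaleC flip: scaleC_of_real)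
qed (simp add: norm_P_le)

lemma bessel:
  assumes "finite F" shows "(\<Sum>i\<in>F. (norm (P i x))\<^sup>2) \<le> (norm x)\<^sup>2"
proof -
  define s where "s = (\<Sum>i\<in>F. (norm (P i x))\<^sup>2)"
  have "(norm (\<Sum>i\<in>F. P i x))\<^sup>2 = s"
    unfolding s_def using assms
    by (rule norm_sum_Pythagorean) (auto simp: pairwise_def orthogonal_def intro: H_orth P_mem)
  moreover have "inner x (\<Sum>i\<in>F. P i x) = s"
    unfolding s_def inner_sum_right
    by (intro sum.cong refl) (metis inner_P_right P_mem inner_commute power2_norm_eq_inner)
  moreover have "(norm (x - (\<Sum>i\<in>F. P i x)))\<^sup>2
      = (norm x)\<^sup>2 - 2 * inner x (\<Sum>i\<in>F. P i x) + (norm (\<Sum>i\<in>F. P i x))\<^sup>2"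
    by (simp add: power2_norm_eq_inner inner_diff inner_commute)
  ultimately show ?thesis
    unfolding s_def[symmetric] using zero_le_power2[of "norm (x - (\<Sum>i\<in>F. P i x))"] by linarith
qed

text \<open>Bessel makes the projections summable. Their sum has the same inner products with all
  eigenvectors as \<open>x\<close>, so completeness identifies the two.\<close>

lemma P_has_sum: "((\<lambda>m. P m x) has_sum x) UNIV"
  and parseval: "((\<lambda>m. (norm (P m x))\<^sup>2) has_sum (norm x)\<^sup>2) UNIV"
proof -
  have orth: "inner (P i x) (P j x) = 0" if "i \<noteq> j" for i j
    using that by (rule H_orth[OF _ P_mem P_mem])
  note 1 = orthogonal_summable[of "\<lambda>m. P m x", OF orth bessel]
  note 2 = orthogonal_has_sum_norm2[of "\<lambda>m. P m x", OF orth bessel]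
  define y where "y = (\<Sum>\<^sub>\<infinity>m. P m x)"
  have y: "((\<lambda>m. P m x) has_sum y) UNIV" unfolding y_def by (rule has_sum_infsum[OF 1])
  have "y - x = 0"
  proof (rule orthogonal_to_eigenspaces_eq_0)
    fix m h assume h: "h \<in> H m"
    have "((\<lambda>j. inner h (P j x)) has_sum inner h y) UNIV"
      by (rule has_sum_bounded_linear[OF bounded_linear_inner_right y])
    moreover have "((\<lambda>j. inner h (P j x)) has_sum inner h x) UNIV"
      by (rule has_sum_finite_neutralI[where B="{m}"])
         (use h in \<open>auto simp: inner_P_right intro: H_orth[OF _ h P_mem]\<close>)
    ultimately have "inner h y = inner h x" by (rule has_sum_unique)
    then show "inner h (y - x) = 0" by (simp add: inner_diff_right)
  qed
  then show "((\<lambda>m. P m x) has_sum x) UNIV" "((\<lambda>m. (norm (P m x))\<^sup>2) has_sum (norm x)\<^sup>2) UNIV"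
    using y 2 unfolding y_def by simp_all
qed

lemma bounded_linear_eqI:
  fixes f g :: "'a \<Rightarrow> 'a"
  assumes f: "bounded_linear f" and g: "bounded_linear g"
    and eq: "\<And>n h. h \<in> H n \<Longrightarrow> f h = g h"
  shows "f x = g x"
proof -
  have "((\<lambda>m. f (P m x)) has_sum f x) UNIV" "((\<lambda>m. g (P m x)) has_sum g x) UNIV"
    by (intro has_sum_bounded_linear[OF _ P_has_sum] f g)+
  moreover have "f (P m x) = g (P m x)" for m by (rule eq[OF P_mem])
  ultimately show ?thesis by (simp add: has_sum_unique)
qed

subsection \<open>Diagonals\<close>

lemma P_A: assumes y: "y \<in> dom D" shows "P i (A y) = of_int i *\<^sub>R P i y"
proof (rule P_eqI)
  show "of_int i *\<^sub>R P i y \<in> H i"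
    using complex_subspace_imp_subspace[OF complex_subspace_H] P_mem by (rule subspace_scale)
  fix h assume h: "h \<in> H i"
  then show "inner h (A y - of_int i *\<^sub>R P i y) = 0"
    using A_symmetric[OF y, of h] by (simp add: mem_H S_def inner_diff_right inner_P_right[OF h])
qed

text \<open>An explicit candidate for the diagonal that \<open>diag_proj\<close> only describes;
  \<open>diag_proj_eq\<close> identifies them.\<close>

definition rho :: "int \<Rightarrow> ('a \<Rightarrow>\<^sub>L 'a) \<Rightarrow> 'a \<Rightarrow> 'a" where
  "rho k a x = (\<Sum>\<^sub>\<infinity>j. P (j + k) (a (P j x)))"

context
  fixes a :: "'a \<Rightarrow>\<^sub>L 'a"
begin

text \<open>For fixed \<open>k\<close> the terms lie in distinct eigenspaces, and Bessel for
  \<open>x\<close> bounds their squares.\<close>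

lemma rho_has_sum: "((\<lambda>j. P (j + k) (a (P j x))) has_sum rho k a x) UNIV"
  and rho_norm2: "((\<lambda>j. (norm (P (j + k) (a (P j x))))\<^sup>2) has_sum (norm (rho k a x))\<^sup>2) UNIV"
  and norm_rho_le: "norm (rho k a x) \<le> norm x * norm a"
proof -
  have orth: "inner (P (i + k) (a (P i x))) (P (j + k) (a (P j x))) = 0" if "i \<noteq> j" for i j
    using that by (intro H_orth[OF _ P_mem P_mem]) simp
  have bound: "(\<Sum>j\<in>F. (norm (P (j + k) (a (P j x))))\<^sup>2) \<le> (norm x * norm a)\<^sup>2" if "finite F" for F
  proof -
    have "(\<Sum>j\<in>F. (norm (P (j + k) (a (P j x))))\<^sup>2) \<le> (\<Sum>j\<in>F. (norm a)\<^sup>2 * (norm (P j x))\<^sup>2)"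
      unfolding power_mult_distrib[symmetric]
      by (intro sum_mono power_mono order.trans[OF norm_P_le norm_blinfun]) simp
    also have "\<dots> \<le> (norm a)\<^sup>2 * (norm x)\<^sup>2"
      unfolding sum_distrib_left[symmetric] by (intro mult_left_mono bessel that) simp
    finally show ?thesis by (simp add: power_mult_distrib mult.commute)
  qed
  note 1 = orthogonal_summable[OF orth bound] and 2 = orthogonal_has_sum_norm2[OF orth bound]
  show "((\<lambda>j. P (j + k) (a (P j x))) has_sum rho k a x) UNIV"
    unfolding rho_def using has_sum_infsum[OF 1] by simp
  show 3: "((\<lambda>j. (norm (P (j + k) (a (P j x))))\<^sup>2) has_sum (norm (rho k a x))\<^sup>2) UNIV"
    unfolding rho_def using 2 by simp
  have "(norm (rho k a x))\<^sup>2 \<le> (norm x * norm a)\<^sup>2"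
    using has_sum_le_finite_sums[OF 3 bound] by simp
  then show "norm (rho k a x) \<le> norm x * norm a" by (rule power2_le_imp_le) simp
qed

lemma bounded_linear_rho: "bounded_linear (rho k a)"
proof (rule bounded_linear_intro)
  note simps = linear_simps[OF bounded_linear_P] blinfun.add_right blinfun.scaleR_right
  show "rho k a (x + y) = rho k a x + rho k a y" for x y
    using has_sum_add[OF rho_has_sum rho_has_sum, of k x k y] rho_has_sum[of k "x + y"]
    by (simp add: simps has_sum_unique)
  show "rho k a (r *\<^sub>R x) = r *\<^sub>R rho k a x" for r x
    using has_sum_bounded_linear[OF bounded_linear_scaleR_right rho_has_sum, of r k x]
      rho_has_sum[of k "r *\<^sub>R x"]
    by (simp add: simps has_sum_unique)
qed (rule norm_rho_le)

lemma rho_of_H: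
  assumes h: "h \<in> H n" shows "rho k a h = P (n + k) (a h)"
proof (rule has_sum_unique[OF rho_has_sum])
  show "((\<lambda>j. P (j + k) (a (P j h))) has_sum P (n + k) (a h)) UNIV"
    by (rule has_sum_finite_neutralI[where B="{n}"])
       (auto simp: P_of_H[OF h] blinfun.zero_right linear_simps[OF bounded_linear_P])
qed

text \<open>With the finite sum over \<open>m\<close> moved inside the series over \<open>j\<close>,
  the bound is a termwise comparison with Parseval for \<open>x\<close>.\<close>

lemma sum_rho_norm2_le:
  assumes comm: "commutator_le_one D a" and F: "finite F"
  shows "(\<Sum>m\<in>F. (of_int m * norm (rho m a x))\<^sup>2) \<le> (norm x)\<^sup>2"
proof (rule has_sum_mono[OF _ parseval])
  show "((\<lambda>j. \<Sum>m\<in>F. (of_int m)\<^sup>2 * (norm (P (j + m) (a (P j x))))\<^sup>2) has_sum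
      (\<Sum>m\<in>F. (of_int m * norm (rho m a x))\<^sup>2)) UNIV"
    unfolding power_mult_distrib by (intro has_sum_finite_sum F has_sum_cmult_right rho_norm2)
  fix j
  define h where "h = P j x"
  have h: "h \<in> dom D" "A h = of_int j *\<^sub>R h"
    using P_mem[of j x] by (auto simp: mem_H S_def h_def)
  define v where "v = A (a h) - a (A h)"
  have ah: "a h \<in> dom D" and v: "norm v \<le> norm h"
    using comm h(1) unfolding commutator_le_one_def v_def by blast+
  \<comment> \<open>Under \<open>P (j + m)\<close>, \<open>D\<close> acts on the left as
    \<open>j + m\<close> and on \<open>h\<close> as \<open>j\<close>; the difference is
    \<open>m\<close>.\<close>
  have Pv: "P (j + m) v = of_int m *\<^sub>R P (j + m) (a h)" for m
    unfolding v_def h(2)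
    by (simp add: linear_simps[OF bounded_linear_P] blinfun.scaleR_right P_A[OF ah] algebra_simps)
  have "(\<Sum>m\<in>F. (of_int m)\<^sup>2 * (norm (P (j + m) (a h)))\<^sup>2) = (\<Sum>m\<in>F. (norm (P (j + m) v))\<^sup>2)"
    by (simp add: Pv power_mult_distrib)
  also have "\<dots> = (\<Sum>i\<in>(+) j ` F. (norm (P i v))\<^sup>2)" by (simp add: sum.reindex)
  also have "\<dots> \<le> (norm v)\<^sup>2" using F by (intro bessel) simp
  also have "\<dots> \<le> (norm h)\<^sup>2" using v by (rule power_mono) simp
  finally show "(\<Sum>m\<in>F. (of_int m)\<^sup>2 * (norm (P (j + m) (a (P j x))))\<^sup>2) \<le> (norm (P j x))\<^sup>2"
    by (simp add: h_def)
qed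

context
  assumes a: "a \<in> bounded_ops"
begin

lemma rho_scaleC: "rho k a (c *\<^sub>C x) = c *\<^sub>C rho k a x"
  using has_sum_bounded_linear[OF bounded_linear_scaleC rho_has_sum, of c k x]
    rho_has_sum[of k "c *\<^sub>C x"] a
  by (simp add: P_scaleC bounded_ops_def has_sum_unique)

text \<open>Completeness is what gives uniqueness: entries determine each \<open>z h\<close> for an
  eigenvector \<open>h\<close>, and these values determine a bounded operator.\<close>

lemma diag_proj_eq: "blinfun_apply (diag_proj D k a) = rho k a"
proof -
  define y where "y = Blinfun (rho k a)"
  have y: "blinfun_apply y = rho k a"
    unfolding y_def by (rule bounded_linear_Blinfun_apply[OF bounded_linear_rho])
  have me: "matrix_entry D b m h = P m (b h)" for b m h
    by (simp add: matrix_entry_def P_def)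
  have ent: "P m (rho k a h) = (if m - n = k then P m (a h) else 0)" if "h \<in> H n" for m n h
    by (auto simp: rho_of_H[OF that] P_of_H[OF P_mem])
  have "diag_proj D k a = y"
    unfolding diag_proj_def me
  proof (rule the_equality)
    show "y \<in> bounded_ops \<and> (\<forall>m n. \<forall>h\<in>H n. P m (y h) = (if m - n = k then P m (a h) else 0))"
      using ent by (auto simp: bounded_ops_def y rho_scaleC)
  next
    fix z assume z: "z \<in> bounded_ops \<and> (\<forall>m n. \<forall>h\<in>H n. P m (z h) = (if m - n = k then P m (a h) else 0))"
    have eq: "z h = y h" if h: "h \<in> H n" for n h
    proof -
      have "P m (z h) = P m (y h)" for m using z h ent[OF h, of m] by (simp add: y)
      then show ?thesis using P_has_sum[of "z h"] P_has_sum[of "y h"] by (simp add: has_sum_unique)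
    qed
    show "z = y"
      by (rule blinfun_eqI, rule bounded_linear_eqI[OF blinfun.bounded_linear_right
            blinfun.bounded_linear_right eq])
  qed
  then show ?thesis by (simp add: y)
qed

section \<open>Norm bounds and convergence of sums of diagonals\<close>

lemma norm_sum_diag_proj_le:
  assumes comm: "commutator_le_one D a" and F: "finite F" "0 \<notin> F"
  shows "norm (\<Sum>m\<in>F. diag_proj D m a) \<le> sqrt (\<Sum>m\<in>F. 1 / (of_int m)\<^sup>2)"
proof (rule norm_blinfun_bound)
  show "0 \<le> sqrt (\<Sum>m\<in>F. 1 / (of_int m)\<^sup>2)" by (simp add: sum_nonneg)
  fix x
  have "norm (blinfun_apply (\<Sum>m\<in>F. diag_proj D m a) x) \<le> (\<Sum>m\<in>F. norm (rho m a x))"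
    unfolding blinfun.sum_left diag_proj_eq by (rule norm_sum)
  \<comment> \<open>The weights that suit Cauchy--Schwarz; they are legitimate because
    \<open>0 \<notin> F\<close>.\<close>
  also have "\<dots> = (\<Sum>m\<in>F. 1 / of_int m * (of_int m * norm (rho m a x)))"
    using F(2) by (intro sum.cong refl) auto
  also have "\<dots> \<le> sqrt (\<Sum>m\<in>F. 1 / (of_int m)\<^sup>2) * norm x"
  proof (rule power2_le_imp_le)
    have "(\<Sum>m\<in>F. 1 / of_int m * (of_int m * norm (rho m a x)))\<^sup>2
        \<le> (\<Sum>m\<in>F. (1 / of_int m)\<^sup>2) * (\<Sum>m\<in>F. (of_int m * norm (rho m a x))\<^sup>2)"
      by (rule Cauchy_Schwarz_ineq_sum)
    also have "\<dots> \<le> (\<Sum>m\<in>F. (1 / of_int m)\<^sup>2) * (norm x)\<^sup>2"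
      by (intro mult_left_mono sum_rho_norm2_le comm F sum_nonneg) simp
    also have "\<dots> = (sqrt (\<Sum>m\<in>F. 1 / (of_int m)\<^sup>2) * norm x)\<^sup>2"
      by (simp add: power_mult_distrib power_divide sum_nonneg)
    finally show "(\<Sum>m\<in>F. 1 / of_int m * (of_int m * norm (rho m a x)))\<^sup>2 \<le> \<dots>" .
  qed (simp add: sum_nonneg)
  finally show "norm (blinfun_apply (\<Sum>m\<in>F. diag_proj D m a) x)
      \<le> sqrt (\<Sum>m\<in>F. 1 / (of_int m)\<^sup>2) * norm x" .
qed

text \<open>On \<open>h\<close> in \<open>H i\<close> the diagonals are the projections of
  \<open>a h\<close>, with indices shifted by \<open>i\<close>. Eigenvectors are enough to identify
  the norm limit later.\<close>

lemma partial_sums_tendsto_pointwise: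
  assumes h: "h \<in> H i"
  shows "(\<lambda>n. blinfun_apply (\<Sum>m\<in>{m. \<bar>m\<bar> \<le> int n}. diag_proj D m a) h) \<longlonglongrightarrow> a h"
proof -
  have "((\<lambda>m. P (i + m) (a h)) has_sum a h) UNIV"
    using P_has_sum[of "a h"] has_sum_reindex_bij_betw[of "\<lambda>m. i + m" UNIV UNIV "\<lambda>m. P m (a h)"]
    by (simp add: bij_plus_right)
  then have "(sum (\<lambda>m. P (i + m) (a h)) \<longlongrightarrow> a h) (finite_subsets_at_top UNIV)"
    by (simp add: has_sum_def)
  from filterlim_compose[OF this filterlim_int_balls] show ?thesis
    by (simp add: blinfun.sum_left diag_proj_eq rho_of_H[OF h])
qed

context
  assumes comm: "commutator_le_one D a"
begin

lemma norm_annulus_le: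
  "norm (\<Sum>m\<in>{m. int k < \<bar>m\<bar> \<and> \<bar>m\<bar> \<le> int n}. diag_proj D m a)
    \<le> sqrt (2 * (\<Sum>i\<in>{k<..n}. 1 / (real i)\<^sup>2))"
  using norm_sum_diag_proj_le[OF comm finite_int_annulus, of k n] unfolding sum_annulus by simp

lemma norm_annulus_le_tail:
  assumes "k \<ge> 1"
  shows "norm (\<Sum>m\<in>{m. int k < \<bar>m\<bar> \<and> \<bar>m\<bar> \<le> int n}. diag_proj D m a) \<le> sqrt (2 / real k)"
  using sum_inverse_squares_tail[OF assms, of n]
  by (intro order.trans[OF norm_annulus_le real_sqrt_le_mono]) simp

lemma annulus_eq_diff:
  assumes "k \<le> n"
  shows "(\<Sum>m\<in>{m. int k < \<bar>m\<bar> \<and> \<bar>m\<bar> \<le> int n}. diag_proj D m a)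
    = (\<Sum>m\<in>{m. \<bar>m\<bar> \<le> int n}. diag_proj D m a) - (\<Sum>m\<in>{m. \<bar>m\<bar> \<le> int k}. diag_proj D m a)"
proof -
  have "{m::int. int k < \<bar>m\<bar> \<and> \<bar>m\<bar> \<le> int n} = {m. \<bar>m\<bar> \<le> int n} - {m. \<bar>m\<bar> \<le> int k}" by auto
  moreover have "finite {m::int. \<bar>m\<bar> \<le> int n}"
    by (rule finite_subset[of _ "{- int n..int n}"]) auto
  ultimately show ?thesis using assms by (simp add: sum_diff subset_eq)
qed

lemma convergent_partial_sums: "convergent (\<lambda>n. \<Sum>m\<in>{m. \<bar>m\<bar> \<le> int n}. diag_proj D m a)"
proof (rule Cauchy_convergent, unfold Cauchy_altdef, intro allI impI)
  fix e :: real assume e: "e > 0"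
  \<comment> \<open>Chosen so that \<open>sqrt (2 / k) < e\<close> for \<open>k > N\<close>; the
    difference of two partial sums is an annulus sum.\<close>
  obtain N :: nat where N: "2 / e\<^sup>2 < real N" using reals_Archimedean2 by blast
  have "norm ((\<Sum>m\<in>{m. \<bar>m\<bar> \<le> int n}. diag_proj D m a) - (\<Sum>m\<in>{m. \<bar>m\<bar> \<le> int k}. diag_proj D m a)) < e"
    if k: "k \<ge> Suc N" and n: "n > k" for k n
  proof -
    have "2 / e\<^sup>2 < real k" using N k by linarith
    then have "2 / real k < e\<^sup>2" using e k by (simp add: field_simps)
    then have "sqrt (2 / real k) < e" using e by (intro real_less_lsqrt) auto
    then show ?thesis
      using norm_annulus_le_tail[of k n] annulus_eq_diff[of k n] k n by simp
  qed
  then show "\<exists>M. \<forall>k\<ge>M. \<forall>n>k. dist (\<Sum>m\<in>{m. \<bar>m\<bar> \<le> int k}. diag_proj D m a)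
      (\<Sum>m\<in>{m. \<bar>m\<bar> \<le> int n}. diag_proj D m a) < e"
    unfolding dist_norm by (metis norm_minus_commute)
qed

lemma norm_tail_le:
  assumes k: "k \<ge> 1"
  shows "norm (lim (\<lambda>n. \<Sum>m\<in>{m. int k < \<bar>m\<bar> \<and> \<bar>m\<bar> \<le> int n}. diag_proj D m a)) \<le> sqrt (2 / real k)"
proof -
  obtain l where l: "(\<lambda>n. \<Sum>m\<in>{m. \<bar>m\<bar> \<le> int n}. diag_proj D m a) \<longlonglongrightarrow> l"
    using convergent_partial_sums by (auto simp: convergent_def)
  have "(\<lambda>n. \<Sum>m\<in>{m. int k < \<bar>m\<bar> \<and> \<bar>m\<bar> \<le> int n}. diag_proj D m a)
      \<longlonglongrightarrow> l - (\<Sum>m\<in>{m. \<bar>m\<bar> \<le> int k}. diag_proj D m a)" (is "?T \<longlonglongrightarrow> ?l")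
    by (rule Lim_transform_eventually[OF tendsto_diff[OF l tendsto_const]])
       \<comment> \<open>The annulus is a difference of balls only from \<open>n = k\<close>
         on.\<close>
       (auto intro!: eventually_sequentiallyI[of k] simp: annulus_eq_diff)
  note T = this
  have "norm ?l \<le> sqrt (2 / real k)"
    by (rule LIMSEQ_le_const2[OF tendsto_norm[OF T]]) (use norm_annulus_le_tail[OF k] in blast)
  then show ?thesis by (simp only: limI[OF T])
qed

text \<open>The norm limit of the partial sums agrees with \<open>a\<close> on eigenvectors, hence
  equals \<open>a\<close>. With the main diagonal zero, each partial sum is an annulus sum with
  \<open>k = 0\<close>, and the Basel sum yields \<open>2 * pi^2/6 = pi^2/3\<close> under the
  root.\<close>

lemma norm_le_of_diag_zero:
  assumes zero: "diag_proj D 0 a = 0"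
  shows "norm a \<le> pi / sqrt 3"
proof -
  let ?S = "\<lambda>n. \<Sum>m\<in>{m. \<bar>m\<bar> \<le> int n}. diag_proj D m a"
  obtain l where l: "?S \<longlonglongrightarrow> l"
    using convergent_partial_sums by (auto simp: convergent_def)
  have eq: "l h = a h" if h: "h \<in> H i" for i h
    using LIMSEQ_unique[OF bounded_linear.tendsto[OF blinfun.bounded_linear_left l] partial_sums_tendsto_pointwise[OF h]] .
  have la: "l = a"
    by (rule blinfun_eqI, rule bounded_linear_eqI[OF blinfun.bounded_linear_right
          blinfun.bounded_linear_right eq])
  have "norm (?S n) \<le> pi / sqrt 3" for n
  proof -
    have "{m. \<bar>m\<bar> \<le> int 0} = {0::int}" by auto
    then have "norm (?S n) = norm (\<Sum>m\<in>{m. int 0 < \<bar>m\<bar> \<and> \<bar>m\<bar> \<le> int n}. diag_proj D m a)"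
      using annulus_eq_diff[of 0 n] zero by simp
    also have "\<dots> \<le> sqrt (2 * (\<Sum>i\<in>{0<..n}. 1 / (real i)\<^sup>2))" by (rule norm_annulus_le)
    also have "\<dots> \<le> sqrt (2 * (pi\<^sup>2 / 6))" using sum_inverse_squares_le[of n] by simp
    also have "\<dots> = pi / sqrt 3" by (simp add: real_sqrt_divide)
    finally show ?thesis .
  qed
  then have "norm l \<le> pi / sqrt 3" by (intro LIMSEQ_le_const2[OF tendsto_norm[OF l]]) blast
  then show ?thesis by (simp only: la)
qed

end
end
end
end

theorem theorem3p4:
  fixes D :: "'a::complex_hilbert_space \<rightharpoonup> 'a"
  assumes "self_adjoint D"
    and "operator_spectrum D \<subseteq> \<int>"
  shows "(\<forall>a\<in>K_set D. norm a \<le> pi / sqrt 3) \<and>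
    (\<forall>a\<in>bounded_ops. commutator_le_one D a \<longrightarrow>
       convergent (\<lambda>n::nat. \<Sum>m\<in>{m::int. \<bar>m\<bar> \<le> int n}. diag_proj D m a) \<and>
       (\<forall>k::nat. k \<ge> 1 \<longrightarrow>
          norm (lim (\<lambda>n::nat. \<Sum>m\<in>{m::int. int k < \<bar>m\<bar> \<and> \<bar>m\<bar> \<le> int n}. diag_proj D m a))
            \<le> sqrt (2 / real k)))"
proof -
  interpret integer_spectrum D by unfold_locales (fact assms)+
  show ?thesis
    using norm_le_of_diag_zero convergent_partial_sums norm_tail_le by (auto simp: K_set_def)
qed

end
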